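(* Let $\nu_0=\sqrt{1-\sin^2 1}$ and $\nu_1=-\dfrac{\sin 2}{1+\cos 2}$. Let $\beta_1,\beta_2>0$ be real numbers with $2\nu_0(\beta_1+\beta_2\nu_1)\geq \pi$. Let $p$ be an analytic function in $\mathbb{D}$ with $p(0)=1$ and $$1+\beta_1 zp'(z)+\beta_2 z^2p''(z)\prec 1+\sinh^{-1}z.$$ Then $p(z)\prec 1+\sin z$.
   Context: $\mathbb{D}=\{z\in\mathbb{C}:|z|<1\}$. For functions $f,g$ analytic in $\mathbb{D}$, $f\prec g$ ($f$ is subordinate to $g$) means there is an analytic $w:\mathbb{D}\to\mathbb{C}$ with $w(0)=0$ and $|w(z)|\leq|z|$ such that $f(z)=g(w(z))$ for all $z\in\mathbb{D}$. $\sinh^{-1}z=\log(z+\sqrt{1+z^2})$ is the principal branch of the inverse hyperbolic sine, analytic on $\mathbb{D}$ with value $0$ at $0$. Numerically $\nu_0\approx 0.540302$, $\nu_1\approx -1.55741$. *)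

theory Defs
  imports "HOL-Complex_Analysis.Complex_Analysis"
begin

(* Subordination on the open unit disc, meant for f and g analytic on ball 0 1.
   The values of f and g outside the disc are irrelevant, because the bound on w
   keeps w z inside it. *)
definition subordinate :: "(complex \<Rightarrow> complex) \<Rightarrow> (complex \<Rightarrow> complex) \<Rightarrow> bool"
    (infix "\<prec>" 50) where
  "f \<prec> g \<longleftrightarrow> (\<exists>w. w analytic_on ball 0 1 \<and> w 0 = 0 \<and>
     (\<forall>z\<in>ball 0 1. norm (w z) \<le> norm z) \<and>
     (\<forall>z\<in>ball 0 1. f z = g (w z)))"

definition nu0 :: real where
  "nu0 = sqrt (1 - (sin 1)\<^sup>2)"

definition nu1 :: real where
  "nu1 = - (sin 2 / (1 + cos 2))"

end

(* The values of arsinh on the disc satisfy |arsinh z| <= (pi/2) |z|, so after division by z the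
   hypothesis says that |beta1 q + beta2 z q'| <= pi/2 for q = p'. Solving this first-order
   equation along radii gives |q| <= pi / (2 beta1) <= cos 1, hence |p(z) - 1| <= cos 1 |z|.
   Since |Arcsin u| <= (pi/2) |u| and (pi/2) cos 1 <= 1, the function w = Arcsin (p - 1)
   satisfies |w(z)| <= |z|. *)
theory Submission
  imports Defs
begin

text \<open>The square of \<open>cos (Arcsin u)\<close> is 1 - u^2. For |u| < 1 this bounds the
  derivative 1 / cos (Arcsin u) of \<open>Arcsin\<close> by the derivative of the real
  \<open>arcsin\<close> at |u|.\<close>

lemma norm_cos_Arcsin_ge:
  "sqrt (1 - (norm u)\<^sup>2) \<le> norm (cos (Arcsin u))"
proof -
  have "1 - (norm u)\<^sup>2 \<le> norm (1 - u\<^sup>2)"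
    by (metis norm_one norm_power norm_triangle_ineq2)
  also have "1 - u\<^sup>2 = (cos (Arcsin u))\<^sup>2"
    by (simp add: cos_squared_eq)
  finally show ?thesis
    by (simp add: norm_power real_le_lsqrt)
qed

text \<open>Along the segment t u, the derivative of Arcsin (t u) in t is dominated in norm by that
  of arcsin (t |u|), and both functions vanish at t = 0.\<close>

lemma norm_Arcsin_le_arcsin:
  assumes "norm u < 1"
  shows "norm (Arcsin u) \<le> arcsin (norm u)"
proof -
  have small: "t * norm u < 1" "-1 < t * norm u" if "0 \<le> t" "t \<le> 1" for t
  proof -
    have "0 \<le> t * norm u" "t * norm u \<le> norm u"
      using that by (auto simp: mult_left_le_one_le)
    then show "t * norm u < 1" "-1 < t * norm u" using assms by linarith+
  qed
  have re: "\<bar>Re (of_real t * u)\<bar> < 1" if "0 \<le> t" "t \<le> 1" for t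
    using abs_Re_le_cmod[of "of_real t * u"] small[OF that] that by (simp add: norm_mult)
  have "norm (Arcsin (of_real 1 * u) - Arcsin (of_real 0 * u))
      \<le> arcsin (1 * norm u) - arcsin (0 * norm u)"
  proof (rule differentiable_bound_general)
    show "continuous_on {0..1} (\<lambda>t. Arcsin (of_real t * u))"
      by (rule continuous_on_compose2[OF continuous_on_Arcsin[of "(\<lambda>t. of_real t * u) ` {0..1}"]])
         (use re in \<open>auto intro!: continuous_intros\<close>)
    show "continuous_on {0..1} (\<lambda>t. arcsin (t * norm u))"
      using small by (intro continuous_intros) (auto intro!: continuous_intros simp: less_imp_le)
  next
    fix t :: real assume t: "0 < t" "t < 1"
    then have t': "0 \<le> t" "t \<le> 1" by auto
    show "((\<lambda>t. Arcsin (of_real t * u)) has_vector_derivative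
        (u * inverse (cos (Arcsin (of_real t * u))))) (at t)"
      by (rule field_vector_diff_chain_at[where f = "\<lambda>t. of_real t * u" and g = Arcsin, unfolded o_def])
         (use re[OF t'] in \<open>auto intro!: derivative_eq_intros\<close>)
    show "((\<lambda>t. arcsin (t * norm u)) has_vector_derivative
        norm u * inverse (sqrt (1 - (t * norm u)\<^sup>2))) (at t)"
      unfolding has_real_derivative_iff_has_vector_derivative[symmetric]
      using small[OF t'] by (auto intro!: derivative_eq_intros simp: power2_eq_square)
    have "(t * norm u)\<^sup>2 < 1"
      using small[OF t'] by (simp add: abs_square_less_1)
    then have "inverse (norm (cos (Arcsin (of_real t * u)))) \<le> inverse (sqrt (1 - (t * norm u)\<^sup>2))"
      using norm_cos_Arcsin_ge[of "of_real t * u"] t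
      by (intro le_imp_inverse_le) (auto simp: norm_mult)
    then show "norm (u * inverse (cos (Arcsin (of_real t * u))))
        \<le> norm u * inverse (sqrt (1 - (t * norm u)\<^sup>2))"
      by (simp add: norm_mult norm_inverse mult_left_mono)
  qed auto
  then show ?thesis by simp
qed

text \<open>Jordan's inequality: sine is concave on [0, pi/2], so its graph lies above the chord
  from (0, 0) to (pi/2, 1).\<close>

lemma sin_ge_chord:
  fixes x :: real
  assumes "0 \<le> x" "x \<le> pi / 2"
  shows "2 / pi * x \<le> sin x"
proof -
  have "concave_on {0..pi/2} (sin :: real \<Rightarrow> real)"
    by (rule f''_le0_imp_concave[where f' = cos and f'' = "\<lambda>x. - sin x"])
       (auto intro!: derivative_eq_intros sin_ge_zero)
  from concave_onD[OF this, of "2 / pi * x" 0 "pi / 2"] show ?thesis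
    using assms by (simp add: field_simps)
qed

lemma norm_Arcsin_le:
  assumes "norm u < 1"
  shows "norm (Arcsin u) \<le> pi / 2 * norm u"
proof -
  \<comment> \<open>Jordan's inequality at x = arcsin |u|, where sin x = |u|.\<close>
  have "2 / pi * arcsin (norm u) \<le> norm u"
    using sin_ge_chord[OF arcsin_nonneg arcsin_ubound, of "norm u"] norm_ge_zero[of u] assms
    by (simp del: norm_ge_zero)
  then show ?thesis
    using norm_Arcsin_le_arcsin[OF assms] by (simp add: field_simps)
qed

lemma norm_arsinh_le:
  fixes z :: complex
  assumes "norm z < 1"
  shows "norm (arsinh z) \<le> pi / 2 * norm z"
proof -
  \<comment> \<open>Both sides are the principal logarithm of z + sqrt (1 + z^2). The rotation by -i
    preserves norms, so the bound for \<open>Arcsin\<close> carries over.\<close>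
  have "arsinh z = \<i> * Arcsin (- \<i> * z)"
    by (cases "z\<^sup>2 + 1 = 0")
       (simp_all add: arsinh_def Arcsin_def csqrt_conv_powr power_mult_distrib add.commute)
  then show ?thesis
    using norm_Arcsin_le[of "- \<i> * z"] assms by (simp add: norm_mult)
qed

text \<open>Multiplying by the integrating factor \<open>t powr (\<beta>1 / \<beta>2 - 1)\<close> turns the left-hand side of \<open>bound\<close>,
  taken at \<open>t z\<close>, into the derivative of \<open>\<beta>2 * t powr (\<beta>1 / \<beta>2) * q (t z)\<close>.\<close>
lemma norm_le_of_euler_operator:
  fixes q :: "complex \<Rightarrow> complex" and \<beta>1 \<beta>2 C :: real
  assumes pos: "\<beta>1 > 0" "\<beta>2 > 0"
    and hol: "q holomorphic_on ball 0 1"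
    and bound: "\<And>z. z \<in> ball 0 1 \<Longrightarrow> z \<noteq> 0 \<Longrightarrow> norm (of_real \<beta>1 * q z + of_real \<beta>2 * z * deriv q z) \<le> C"
    and z: "z \<in> ball 0 1" "z \<noteq> 0"
  shows "norm (q z) \<le> C / \<beta>1"
proof -
  define \<alpha> where "\<alpha> = \<beta>1 / \<beta>2"
  have \<alpha>: "\<alpha> > 0" and \<beta>1: "\<beta>1 = \<alpha> * \<beta>2" using pos by (simp_all add: \<alpha>_def)
  have inball: "of_real t * z \<in> ball 0 1" if "0 \<le> t" "t \<le> 1" for t
    using that z(1) mult_left_le_one_le[of "norm z" t] by (auto simp: norm_mult)
  \<comment> \<open>Since \<alpha> > 0, the weight t^\<alpha> is continuous on [0, 1] and vanishes
    at 0, so no term with q(0) survives and the left side is |q(z)|.\<close>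
  have "norm ((1 powr \<alpha>) *\<^sub>R q (of_real 1 * z) - (0 powr \<alpha>) *\<^sub>R q (of_real 0 * z))
      \<le> C / \<beta>1 * 1 powr \<alpha> - C / \<beta>1 * 0 powr \<alpha>"
  proof (rule differentiable_bound_general)
    have powr: "continuous_on {0..1} (\<lambda>t::real. t powr \<alpha>)"
      using \<alpha> by (intro continuous_on_powr') (auto intro!: continuous_intros)
    have "continuous_on {0..1} (\<lambda>t. q (of_real t * z))"
      by (rule continuous_on_compose2[OF holomorphic_on_imp_continuous_on[OF hol]])
         (use inball in \<open>auto intro!: continuous_intros\<close>)
    with powr show "continuous_on {0..1} (\<lambda>t. (t powr \<alpha>) *\<^sub>R q (of_real t * z))"
      by (rule continuous_on_scaleR)
    from powr show "continuous_on {0..1} (\<lambda>t. C / \<beta>1 * t powr \<alpha>)"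
      by (rule continuous_on_mult_left)
  next
    fix t :: real assume t: "0 < t" "t < 1"
    let ?u = "of_real t * z"
    \<comment> \<open>\<open>bound\<close> speaks of nonzero points only; t > 0 ensures that t z is
      one.\<close>
    have u: "?u \<in> ball 0 1" "?u \<noteq> 0" using t z inball[of t] by auto
    have dp: "((\<lambda>t. t powr \<alpha>) has_real_derivative \<alpha> * t powr (\<alpha> - 1)) (at t)"
      using t by (auto intro!: derivative_eq_intros)
    then show "((\<lambda>t. C / \<beta>1 * t powr \<alpha>) has_vector_derivative C / \<beta>2 * t powr (\<alpha> - 1)) (at t)"
      unfolding has_real_derivative_iff_has_vector_derivative[symmetric]
      using DERIV_cmult[OF dp, of "C / \<beta>1"] pos by (simp add: \<alpha>_def)
    have dq: "((\<lambda>t. q (of_real t * z)) has_vector_derivative z * deriv q ?u) (at t)"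
      by (rule field_vector_diff_chain_at[where f = "\<lambda>t. of_real t * z" and g = q, unfolded o_def])
         (use holomorphic_derivI[OF hol open_ball u(1)] in \<open>auto intro!: derivative_eq_intros\<close>)
    \<comment> \<open>This splits off the common factor t^(\<alpha> - 1); the remaining t completes
      t z in front of the derivative of q.\<close>
    have tp: "t powr \<alpha> = t powr (\<alpha> - 1) * t"
      using t by (simp add: powr_diff)
    show "((\<lambda>t. (t powr \<alpha>) *\<^sub>R q (of_real t * z)) has_vector_derivative
        (t powr (\<alpha> - 1) / \<beta>2) *\<^sub>R (of_real \<beta>1 * q ?u + of_real \<beta>2 * ?u * deriv q ?u)) (at t)"
      by (rule has_vector_derivative_eq_rhs[OF has_vector_derivative_scaleR[OF dp dq]])
         (use pos in \<open>simp add: tp \<beta>1 scaleR_conv_of_real field_simps\<close>)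
    show "norm ((t powr (\<alpha> - 1) / \<beta>2) *\<^sub>R (of_real \<beta>1 * q ?u + of_real \<beta>2 * ?u * deriv q ?u))
        \<le> C / \<beta>2 * t powr (\<alpha> - 1)"
      using mult_left_mono[OF bound[OF u], of "t powr (\<alpha> - 1) / \<beta>2"] pos
      by (simp add: mult.commute)
  qed auto
  then show ?thesis using \<alpha> by simp
qed

lemma nu0_eq: "nu0 = cos 1"
  using cos_gt_zero_pi[of 1] pi_gt3 by (simp add: nu0_def cos_squared_eq[symmetric])

text \<open>By the half-angle formula \<open>nu1\<close> is -tan 1. Its sign lets the \<beta>2 term
  be dropped from the condition on the parameters.\<close>

lemma nu1_le_0: "nu1 \<le> 0"
proof -
  have "0 \<le> sin (2::real)" using pi_gt3 by (intro sin_ge_zero) auto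
  moreover have "0 \<le> 1 + cos (2::real)" using cos_ge_minus_one[of 2] by linarith
  ultimately show ?thesis by (simp add: nu1_def)
qed

lemma pi_half_mult_cos_1_le: "pi / 2 * cos 1 \<le> 1"
proof -
  have "cos 1 = sin (pi / 2 - 1)" by (simp add: sin_diff)
  also have "\<dots> \<le> pi / 2 - 1" using pi_gt3 by (intro sin_x_le_x) auto
  finally have "pi / 2 * cos 1 \<le> pi / 2 * (pi / 2 - 1)" by (intro mult_left_mono) auto
  \<comment> \<open>From pi < 3.2; the product is 0.96.\<close>
  also have "\<dots> \<le> 16 / 10 * (16 / 10 - 1)"
    using pi_approx by (intro mult_mono) auto
  finally show ?thesis by simp
qed

theorem theorem2p7:
  fixes \<beta>1 \<beta>2 :: real and p :: "complex \<Rightarrow> complex"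
  assumes "\<beta>1 > 0" and "\<beta>2 > 0"
    and "2 * nu0 * (\<beta>1 + \<beta>2 * nu1) \<ge> pi"
    and "p analytic_on ball 0 1" and "p 0 = 1"
    and "(\<lambda>z. 1 + of_real \<beta>1 * z * deriv p z + of_real \<beta>2 * z\<^sup>2 * deriv (deriv p) z)
           \<prec> (\<lambda>z. 1 + arsinh z)"
  shows "p \<prec> (\<lambda>z. 1 + sin z)"
proof -
  have hol: "p holomorphic_on ball 0 1"
    using assms(4) by (simp add: analytic_on_open)
  then have hol': "deriv p holomorphic_on ball 0 1"
    by (intro holomorphic_deriv) auto
  obtain w where w: "\<And>z. z \<in> ball 0 1 \<Longrightarrow> norm (w z) \<le> norm z"
    and eq: "\<And>z. z \<in> ball 0 1 \<Longrightarrow>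
      1 + of_real \<beta>1 * z * deriv p z + of_real \<beta>2 * z\<^sup>2 * deriv (deriv p) z = 1 + arsinh (w z)"
    using assms(6) unfolding subordinate_def by blast
  have bound: "norm (of_real \<beta>1 * deriv p z + of_real \<beta>2 * z * deriv (deriv p) z) \<le> pi / 2"
    if z: "z \<in> ball 0 1" "z \<noteq> 0" for z
  proof -
    \<comment> \<open>Cancelling the 1 in \<open>eq\<close> leaves z times the expression to be
      bounded.\<close>
    have "norm z * norm (of_real \<beta>1 * deriv p z + of_real \<beta>2 * z * deriv (deriv p) z) = norm (arsinh (w z))"
      unfolding norm_mult[symmetric] using eq[OF z(1)] by (simp add: algebra_simps power2_eq_square)
    also have "\<dots> \<le> pi / 2 * norm (w z)"
      using w[OF z(1)] z(1) by (intro norm_arsinh_le) auto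
    also have "\<dots> \<le> norm z * (pi / 2)"
      using w[OF z(1)] by simp
    finally show ?thesis using z(2) by simp
  qed
  have cos1: "0 < cos (1::real)" "cos (1::real) < 1"
    using cos_gt_zero_pi[of 1] cos_monotone_0_pi[of 0 1] pi_gt3 by auto
  \<comment> \<open>As \<beta>2 * \<open>nu1\<close> is at most 0, the condition yields pi <= 2 cos
    1 * \<beta>1, which makes the bound on p' at most cos 1.\<close>
  have "pi \<le> 2 * cos 1 * (\<beta>1 + \<beta>2 * nu1)" using assms(3) by (simp add: nu0_eq)
  also have "\<dots> \<le> 2 * cos 1 * \<beta>1"
    using cos1 nu1_le_0 assms(2) by (simp add: mult_nonneg_nonpos)
  finally have \<beta>1: "pi / 2 / \<beta>1 \<le> cos 1"
    using assms(1) by (simp add: field_simps)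
  have deriv_le: "norm (deriv p z) \<le> cos 1" if "z \<in> ball 0 1 - {0}" for z
    using norm_le_of_euler_operator[OF assms(1,2) hol' bound, of z] that \<beta>1 by auto
  have p_le: "norm (p z - 1) \<le> cos 1 * norm z" if z: "z \<in> ball 0 1" for z
  proof (cases "z = 0")
    case False
    have inball: "of_real t * z \<in> ball 0 1" if "0 \<le> t" "t \<le> 1" for t
      using that z mult_left_le_one_le[of "norm z" t] by (auto simp: norm_mult)
    \<comment> \<open>Integration of p' along the radius from 0 to z. The derivative is estimated
      only for 0 < t < 1, so \<open>deriv_le\<close> away from the origin suffices.\<close>
    have "norm (p (of_real 1 * z) - p (of_real 0 * z)) \<le> cos 1 * norm z * 1 - cos 1 * norm z * 0"
    proof (rule differentiable_bound_general)
      show "continuous_on {0..1} (\<lambda>t. p (of_real t * z))"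
        by (rule continuous_on_compose2[OF holomorphic_on_imp_continuous_on[OF hol]])
           (use inball in \<open>auto intro!: continuous_intros\<close>)
      fix t :: real assume t: "0 < t" "t < 1"
      then have u: "of_real t * z \<in> ball 0 1" using inball[of t] by auto
      show "((\<lambda>t. p (of_real t * z)) has_vector_derivative z * deriv p (of_real t * z)) (at t)"
        by (rule field_vector_diff_chain_at[where f = "\<lambda>t. of_real t * z" and g = p, unfolded o_def])
           (use holomorphic_derivI[OF hol open_ball u] in \<open>auto intro!: derivative_eq_intros\<close>)
      show "((\<lambda>t. cos 1 * norm z * t) has_vector_derivative cos 1 * norm z) (at t)"
        by (auto intro!: derivative_eq_intros)
      show "norm (z * deriv p (of_real t * z)) \<le> cos 1 * norm z"
        using mult_left_mono[OF deriv_le[of "of_real t * z"], of "norm z"] u t False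
        by (simp add: norm_mult mult.commute)
    qed (auto intro!: continuous_intros)
    then show ?thesis using assms(5) by simp
  qed (use assms(5) in simp)
  have p_lt: "norm (p z - 1) < 1" if "z \<in> ball 0 1" for z
    using p_le[OF that] cos1 that mult_left_le_one_le[of "norm z" "cos 1"] by simp
  show ?thesis
    unfolding subordinate_def
  proof (intro exI[of _ "\<lambda>z. Arcsin (p z - 1)"] conjI ballI)
    \<comment> \<open>The strip |Re| < 1 avoids the branch cuts of \<open>Arcsin\<close>, which lie
      on the real axis outside (-1, 1).\<close>
    have "\<bar>Re (p z - 1)\<bar> < 1" if "z \<in> ball 0 1" for z
      using p_lt[OF that] abs_Re_le_cmod[of "p z - 1"] by linarith
    then have "(Arcsin \<circ> (\<lambda>z. p z - 1)) holomorphic_on ball 0 1"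
      using hol
      by (intro holomorphic_on_compose holomorphic_on_Arcsin) (auto intro!: holomorphic_intros)
    then show "(\<lambda>z. Arcsin (p z - 1)) analytic_on ball 0 1"
      by (simp add: analytic_on_open o_def)
    fix z :: complex assume z: "z \<in> ball 0 1"
    have "norm (Arcsin (p z - 1)) \<le> pi / 2 * norm (p z - 1)"
      by (rule norm_Arcsin_le[OF p_lt[OF z]])
    also have "\<dots> \<le> pi / 2 * (cos 1 * norm z)"
      using p_le[OF z] by (intro mult_left_mono) auto
    also have "\<dots> \<le> norm z"
      using mult_right_mono[OF pi_half_mult_cos_1_le, of "norm z"] by (simp add: mult.assoc)
    finally show "norm (Arcsin (p z - 1)) \<le> norm z" .
  qed (use assms(5) in auto)
qed

end
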